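(* Let $\mathfrak{g}_{4,1}^{s}$, $\mathfrak{g}_{4,2}^{s}$, $\mathfrak{g}_{6}^{s}$ be the following complex quadratic Lie superalgebras (all brackets and values of $B$ not determined by those listed via skew-supersymmetry of the bracket, resp. supersymmetry of $B$, are zero). - $\mathfrak{g}_{4,1}^{s}$: even part $\mathrm{span}\{X_{\overline 0},Y_{\overline 0}\}$, odd part $\mathrm{span}\{X_{\overline 1},Y_{\overline 1}\}$, dimension $4$, $B(X_{\overline 0},Y_{\overline 0})=1$, $B(X_{\overline 1},Y_{\overline 1})=1$, and $[Y_{\overline 1},Y_{\overline 1}]=-2X_{\overline 0}$, $[Y_{\overline 0},Y_{\overline 1}]=-2X_{\overline 1}$. - $\mathfrak{g}_{4,2}^{s}$: even part $\mathrm{span}\{X_{\overline 0},Y_{\overline 0}\}$, odd part $\mathrm{span}\{X_{\overline 1},Y_{\overline 1}\}$, dimension $4$, $B(X_{\overline 0},Y_{\overline 0})=1$, $B(X_{\overline 1},Y_{\overline 1})=1$, and $[X_{\overline 1},Y_{\overline 1}]=X_{\overline 0}$, $[Y_{\overline 0},X_{\overline 1}]=X_{\overline 1}$, $[Y_{\overline 0},Y_{\overline 1}]=-Y_{\overline 1}$. - $\mathfrak{g}_{6}^{s}$: even part $\mathrm{span}\{X_{\overline 0},Y_{\overline 0}\}$, odd part $\mathrm{span}\{X_{\overline 1},Y_{\overline 1},Z_{\overline 1},T_{\overline 1}\}$, dimension $6$, $B(X_{\overline 0},Y_{\overline 0})=1$, $B(X_{\overline 1},Z_{\overline 1})=1$,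 $B(Y_{\overline 1},T_{\overline 1})=1$, and $[Z_{\overline 1},T_{\overline 1}]=-X_{\overline 0}$, $[Y_{\overline 0},Z_{\overline 1}]=-Y_{\overline 1}$, $[Y_{\overline 0},T_{\overline 1}]=-X_{\overline 1}$. In each case let a star denote the corresponding element of the dual basis. Then the second cohomology groups with trivial coefficients are: (i) $H^2(\mathfrak{g}_{4,1}^{s},\mathbb{C})=\mathrm{span}\left\{[Y_{\overline 0}^{*}\otimes X_{\overline 1}^{*}],\ [X_{\overline 1}^{*}Y_{\overline 1}^{*}-2X_{\overline 0}^{*}\wedge Y_{\overline 0}^{*}]\right\}$; (ii) $H^2(\mathfrak{g}_{4,2}^{s},\mathbb{C})=\{0\}$; (iii) $H^2(\mathfrak{g}_{6}^{s},\mathbb{C})=\mathrm{span}\left\{[Y_{\overline 0}^{*}\otimes X_{\overline 1}^{*}],\ [Y_{\overline 0}^{*}\otimes Y_{\overline 1}^{*}],\ [(Z_{\overline 1}^{*})^2],\ [(T_{\overline 1}^{*})^2],\ [X_{\overline 1}^{*}Z_{\overline 1}^{*}-X_{\overline 0}^{*}\wedge Y_{\overline 0}^{*}],\ [Y_{\overline 1}^{*}T_{\overline 1}^{*}-X_{\overline 0}^{*}\wedge Y_{\overline 0}^{*}]\right\}$.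
   Context: All vector spaces are finite-dimensional over $\mathbb{C}$. A Lie superalgebra $\mathfrak{g}=\mathfrak{g}_{\overline 0}\oplus\mathfrak{g}_{\overline 1}$ has a bilinear graded bracket with $[X,Y]=-(-1)^{xy}[Y,X]$ for $X\in\mathfrak{g}_x$, $Y\in\mathfrak{g}_y$, satisfying the super Jacobi identity. It is quadratic if it carries a non-degenerate bilinear form $B$ that is supersymmetric ($B(X,Y)=(-1)^{xy}B(Y,X)$), invariant ($B([X,Y],Z)=B(X,[Y,Z])$) and even ($B(\mathfrak{g}_{\overline 0},\mathfrak{g}_{\overline 1})=0$). Cochains: $C^n(\mathfrak{g},\mathbb{C})=\bigoplus_{m=0}^{n}\mathrm{Alt}^m(\mathfrak{g}_{\overline 0},\mathbb{C})\otimes \mathrm{Sym}^{n-m}(\mathfrak{g}_{\overline 1},\mathbb{C})$ (alternating forms on the even part tensor symmetric forms on the odd part), viewed as $n$-linear forms on $\mathfrak{g}$ that are super-skew-symmetric (for $n=2$: $\omega(X,Y)=-(-1)^{xy}\omega(Y,X)$). In degree 2: for $\varphi,\psi\in\mathfrak{g}_{\overline 0}^*$, $(\varphi\wedge\psi)(X,Y)=\varphi(X)\psi(Y)-\varphi(Y)\psi(X)$; for $\varphi,\psi\in\mathfrak{g}_{\overline 1}^*$, $(\varphi\psi)(X,Y)=\varphi(X)\psi(Y)+\varphi(Y)\psi(X)$, and $\varphi^2=\varphi\varphi$; for $\varphi\in\mathfrak{g}_{\overline 0}^*$, $\psi\in\mathfrak{g}_{\overline 1}^*$, $(\varphi\otimes\psi)(X,Y)=\varphi(X)\psi(Y)$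 for $X\in\mathfrak{g}_{\overline 0}$, $Y\in\mathfrak{g}_{\overline 1}$ (and it vanishes on pairs of the same parity). The differential $\delta_k:C^k(\mathfrak{g},\mathbb{C})\to C^{k+1}(\mathfrak{g},\mathbb{C})$ is, for homogeneous $X_i\in\mathfrak{g}_{x_i}$, $$\delta_k\omega(X_0,\ldots,X_k)=\sum_{r<s}(-1)^{s+x_s(x_{r+1}+\cdots+x_{s-1})}\,\omega(X_0,\ldots,X_{r-1},[X_r,X_s],X_{r+1},\ldots,\widehat{X_s},\ldots,X_k),$$ with $\delta_0=0$; it satisfies $\delta^2=0$. Then $H^k(\mathfrak{g},\mathbb{C})=\ker\delta_k/\operatorname{im}\delta_{k-1}$, and $[\omega]$ denotes the class of a cocycle $\omega$. *)

theory Defs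
  imports "HOL-Analysis.Cartesian_Space" "HOL-Library.Z2" "HOL-Library.Function_Algebras"
begin

section \<open>Quadratic Lie superalgebras\<close>

text \<open>Parities live in the two-element field \<^typ>\<open>bit\<close>; \<open>psign x\<close> is $(-1)^x$.\<close>

definition psign :: "bit \<Rightarrow> complex"
  where "psign x = (if x = 0 then 1 else - 1)"

locale lie_superalgebra = vector_space scale
  for scale :: "complex \<Rightarrow> 'v::ab_group_add \<Rightarrow> 'v" (infixr \<open>*\<^sub>V\<close> 75) +
  fixes g :: "bit \<Rightarrow> 'v set"
    and bracket :: "'v \<Rightarrow> 'v \<Rightarrow> 'v"  (\<open>\<lbrakk>_, _\<rbrakk>\<close>)
  assumes finite_dim: "\<exists>A. finite A \<and> span A = UNIV"
    and subspace_part: "subspace (g x)"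
    and parts_disjoint: "g 0 \<inter> g 1 = {0}"
    and parts_span: "\<exists>a\<in>g 0. \<exists>b\<in>g 1. v = a + b"
    and bracket_linear_right: "Vector_Spaces.linear scale scale (\<lambda>w. \<lbrakk>v, w\<rbrakk>)"
    and bracket_linear_left: "Vector_Spaces.linear scale scale (\<lambda>w. \<lbrakk>w, v\<rbrakk>)"
    and bracket_graded: "X \<in> g x \<Longrightarrow> Y \<in> g y \<Longrightarrow> \<lbrakk>X, Y\<rbrakk> \<in> g (x + y)"
    and bracket_skew: "X \<in> g x \<Longrightarrow> Y \<in> g y \<Longrightarrow> \<lbrakk>X, Y\<rbrakk> = - (psign (x * y) *\<^sub>V \<lbrakk>Y, X\<rbrakk>)"
    and super_Jacobi: "X \<in> g x \<Longrightarrow> Y \<in> g y \<Longrightarrow> Z \<in> g z \<Longrightarrow>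
      psign (x * z) *\<^sub>V \<lbrakk>X, \<lbrakk>Y, Z\<rbrakk>\<rbrakk> + psign (y * x) *\<^sub>V \<lbrakk>Y, \<lbrakk>Z, X\<rbrakk>\<rbrakk>
        + psign (z * y) *\<^sub>V \<lbrakk>Z, \<lbrakk>X, Y\<rbrakk>\<rbrakk> = 0"

locale quadratic_lie_superalgebra = lie_superalgebra scale g bracket
  for scale :: "complex \<Rightarrow> 'v::ab_group_add \<Rightarrow> 'v" (infixr \<open>*\<^sub>V\<close> 75)
    and g :: "bit \<Rightarrow> 'v set"
    and bracket :: "'v \<Rightarrow> 'v \<Rightarrow> 'v"  (\<open>\<lbrakk>_, _\<rbrakk>\<close>) +
  fixes B :: "'v \<Rightarrow> 'v \<Rightarrow> complex"
  assumes form_linear_right: "Vector_Spaces.linear scale (*) (\<lambda>w. B v w)"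
    and form_linear_left: "Vector_Spaces.linear scale (*) (\<lambda>w. B w v)"
    and form_nondegenerate: "(\<And>w. B v w = 0) \<Longrightarrow> v = 0"
    and form_supersymmetric: "X \<in> g x \<Longrightarrow> Y \<in> g y \<Longrightarrow> B X Y = psign (x * y) * B Y X"
    and form_invariant: "B \<lbrakk>X, Y\<rbrakk> Z = B X \<lbrakk>Y, Z\<rbrakk>"
    and form_even: "X \<in> g 0 \<Longrightarrow> Y \<in> g 1 \<Longrightarrow> B X Y = 0"


section \<open>Cohomology with trivial coefficients\<close>

text \<open>
  An \<open>n\<close>-linear form is a function on lists which is \<open>0\<close> on all lists of length other than \<open>n\<close>.
  Addition and subtraction of forms are pointwise.
\<close>

definition scale_form :: "complex \<Rightarrow> ('v list \<Rightarrow> complex) \<Rightarrow> 'v list \<Rightarrow> complex"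
  where "scale_form c \<omega> = (\<lambda>xs. c * \<omega> xs)"

context lie_superalgebra
begin

definition component :: "bit \<Rightarrow> 'v \<Rightarrow> 'v"
  where "component x v = (THE a. a \<in> g x \<and> v - a \<in> g (x + 1))"

definition cochains :: "nat \<Rightarrow> ('v list \<Rightarrow> complex) set"
  where "cochains n = {\<omega>.
    (\<forall>xs. length xs \<noteq> n \<longrightarrow> \<omega> xs = 0) \<and>
    (\<forall>us vs. length us + 1 + length vs = n \<longrightarrow>
      Vector_Spaces.linear scale (*) (\<lambda>v. \<omega> (us @ [v] @ vs))) \<and>
    (\<forall>us vs X Y x y. length us + 2 + length vs = n \<longrightarrow> X \<in> g x \<longrightarrow> Y \<in> g y \<longrightarrow>
      \<omega> (us @ [X, Y] @ vs) = - psign (x * y) * \<omega> (us @ [Y, X] @ vs))}"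

text \<open>
  \<open>delta_hom k \<omega> ps xs\<close> is the formula for $\delta_k\omega(X_0,\ldots,X_k)$ at homogeneous
  vectors \<open>xs = [X\<^sub>0, \<dots>, X\<^sub>k]\<close> of parities \<open>ps\<close>; \<open>delta k \<omega>\<close> is its multilinear extension,
  obtained by decomposing every argument into its even and its odd component
  (see \<open>delta_homogeneous\<close>).
\<close>

definition delta_hom :: "nat \<Rightarrow> ('v list \<Rightarrow> complex) \<Rightarrow> bit list \<Rightarrow> 'v list \<Rightarrow> complex"
  where "delta_hom k \<omega> ps xs = (\<Sum>s\<le>k. \<Sum>r<s.
    psign (of_nat s + ps ! s * (\<Sum>i\<in>{r<..<s}. ps ! i)) *
      \<omega> (take r xs @ [\<lbrakk>xs ! r, xs ! s\<rbrakk>] @ map ((!) xs) [Suc r..<s] @ drop (Suc s) xs))"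

definition delta :: "nat \<Rightarrow> ('v list \<Rightarrow> complex) \<Rightarrow> 'v list \<Rightarrow> complex"
  where "delta k \<omega> xs = (if length xs = Suc k
    then \<Sum>ps\<in>{ps. length ps = Suc k}. delta_hom k \<omega> ps (map2 component ps xs) else 0)"

definition cocycles :: "nat \<Rightarrow> ('v list \<Rightarrow> complex) set"
  where "cocycles k = {\<omega> \<in> cochains k. delta k \<omega> = 0}"

fun coboundaries :: "nat \<Rightarrow> ('v list \<Rightarrow> complex) set"
  where "coboundaries 0 = {0}"
  | "coboundaries (Suc k) = delta k ` cochains k"

definition cohom_class :: "nat \<Rightarrow> ('v list \<Rightarrow> complex) \<Rightarrow> ('v list \<Rightarrow> complex) set"
  where "cohom_class k \<omega> = {\<eta>. \<eta> - \<omega> \<in> coboundaries k}"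

definition H :: "nat \<Rightarrow> ('v list \<Rightarrow> complex) set set"
  where "H k = cohom_class k ` cocycles k"

text \<open>
  The vector space structure of the quotient. The summand from \<open>coboundaries k\<close> in \<open>H_scale\<close>
  matters only for the scalar \<open>0\<close>.
\<close>

definition H_zero :: "nat \<Rightarrow> ('v list \<Rightarrow> complex) set"
  where "H_zero k = cohom_class k 0"

definition H_add :: "('v list \<Rightarrow> complex) set \<Rightarrow> ('v list \<Rightarrow> complex) set \<Rightarrow> ('v list \<Rightarrow> complex) set"
  where "H_add a b = {\<alpha> + \<beta> | \<alpha> \<beta>. \<alpha> \<in> a \<and> \<beta> \<in> b}"

definition H_scale :: "nat \<Rightarrow> complex \<Rightarrow> ('v list \<Rightarrow> complex) set \<Rightarrow> ('v list \<Rightarrow> complex) set"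
  where "H_scale k c a = {scale_form c \<alpha> + \<beta> | \<alpha> \<beta>. \<alpha> \<in> a \<and> \<beta> \<in> coboundaries k}"

definition H_subspace :: "nat \<Rightarrow> ('v list \<Rightarrow> complex) set set \<Rightarrow> bool"
  where "H_subspace k W \<longleftrightarrow> W \<subseteq> H k \<and> H_zero k \<in> W \<and>
    (\<forall>a\<in>W. \<forall>b\<in>W. H_add a b \<in> W) \<and> (\<forall>c. \<forall>a\<in>W. H_scale k c a \<in> W)"

text \<open>
  As for \<open>span\<close> in the library. If \<open>S\<close> is not contained in \<open>H k\<close>, no subspace contains it and
  the hull is \<^term>\<open>UNIV\<close>; hence \<open>H k = H_span k S\<close> entails that \<open>S\<close> consists of cohomology classes.
\<close>

definition H_span :: "nat \<Rightarrow> ('v list \<Rightarrow> complex) set set \<Rightarrow> ('v list \<Rightarrow> complex) set set"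
  where "H_span k S = H_subspace k hull S"

lemma component_homogeneous:
  assumes "v \<in> g x"
  shows "component y v = (if y = x then v else 0)"
proof -
  have uniq: "a = b" if "a \<in> g y" "v - a \<in> g (y + 1)" "b \<in> g y" "v - b \<in> g (y + 1)" for a b
  proof -
    have "a - b \<in> g y" using that subspace_diff subspace_part by blast
    moreover have "a - b \<in> g (y + 1)"
      using subspace_diff[OF subspace_part[of "y + 1"] that(4,2)] by simp
    ultimately have "a - b \<in> g 0 \<inter> g 1" by (cases y) auto
    then show ?thesis using parts_disjoint by auto
  qed
  let ?a = "if y = x then v else 0"
  have "?a \<in> g y \<and> v - ?a \<in> g (y + 1)"
    using assms subspace_0[OF subspace_part] by (cases x; cases y) auto
  then show ?thesis unfolding component_def using uniq by (intro the_equality) auto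
qed

lemma cochain_zero_entry:
  assumes "\<omega> \<in> cochains n" "0 \<in> set xs"
  shows "\<omega> xs = 0"
proof (cases "length xs = n")
  case True
  obtain us vs where xs: "xs = us @ [0] @ vs" using assms(2) by (auto dest: split_list)
  then have "Vector_Spaces.linear scale (*) (\<lambda>v. \<omega> (us @ [v] @ vs))"
    using assms(1) True unfolding cochains_def by auto
  then interpret L: Vector_Spaces.linear scale "(*)" "\<lambda>v. \<omega> (us @ [v] @ vs)" .
  show ?thesis using L.zero xs by simp
next
  case False
  then show ?thesis using assms(1) unfolding cochains_def by auto
qed

lemma bracket_zero: "\<lbrakk>0, v\<rbrakk> = 0" "\<lbrakk>v, 0\<rbrakk> = 0"
proof -
  interpret L: Vector_Spaces.linear scale scale "\<lambda>w. \<lbrakk>w, v\<rbrakk>" by (rule bracket_linear_left)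
  interpret R: Vector_Spaces.linear scale scale "\<lambda>w. \<lbrakk>v, w\<rbrakk>" by (rule bracket_linear_right)
  show "\<lbrakk>0, v\<rbrakk> = 0" "\<lbrakk>v, 0\<rbrakk> = 0" using L.zero R.zero by auto
qed

lemma delta_hom_zero_entry:
  assumes "\<omega> \<in> cochains k" "j < length xs" "xs ! j = 0" "length xs = Suc k"
  shows "delta_hom k \<omega> ps xs = 0"
proof -
  have "\<omega> (take r xs @ [\<lbrakk>xs ! r, xs ! s\<rbrakk>] @ map ((!) xs) [Suc r..<s] @ drop (Suc s) xs) = 0"
    if "r < s" "s \<le> k" for r s
  proof (rule cochain_zero_entry[OF assms(1)])
    consider "j < r" | "j = r" | "r < j \<and> j < s" | "j = s" | "s < j" by linarith
    then show "0 \<in> set (take r xs @ [\<lbrakk>xs ! r, xs ! s\<rbrakk>] @ map ((!) xs) [Suc r..<s] @ drop (Suc s) xs)"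
    proof cases
      case 1
      then have "take r xs ! j = 0" "j < length (take r xs)" using assms by auto
      then show ?thesis by (metis UnI1 nth_mem set_append)
    next
      case 3
      then show ?thesis using assms by force
    next
      case 5
      then have "drop (Suc s) xs ! (j - Suc s) = 0" "j - Suc s < length (drop (Suc s) xs)"
        using assms by auto
      then have "0 \<in> set (drop (Suc s) xs)" by (metis nth_mem)
      then show ?thesis by auto
    qed (use assms bracket_zero in auto)
  qed
  then show ?thesis unfolding delta_hom_def by (intro sum.neutral ballI) auto
qed

lemma delta_homogeneous:
  assumes "\<omega> \<in> cochains k" "length xs = Suc k" "length ps = Suc k"
    and hom: "\<And>i. i \<le> k \<Longrightarrow> xs ! i \<in> g (ps ! i)"
  shows "delta k \<omega> xs = delta_hom k \<omega> ps xs"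
proof -
  have fin: "finite {qs :: bit list. length qs = Suc k}"
  proof -
    have "finite (UNIV :: bit set)"
      by (rule finite_subset[of _ "{0, 1}"]) (auto intro: bit.exhaust)
    then show ?thesis using finite_lists_length_eq[of "UNIV :: bit set"] by simp
  qed
  have comp: "component y (xs ! i) = (if y = ps ! i then xs ! i else 0)" if "i < Suc k" for y i
    using component_homogeneous[OF hom] that by simp
  have eq: "map2 component ps xs = xs"
    using assms comp by (intro nth_equalityI) auto
  have "delta_hom k \<omega> qs (map2 component qs xs) = 0"
    if len: "length qs = Suc k" and neq: "qs \<noteq> ps" for qs
  proof -
    obtain j where j: "j < Suc k" "qs ! j \<noteq> ps ! j"
      using len neq assms(3) by (metis nth_equalityI)
    show ?thesis
      by (rule delta_hom_zero_entry[OF assms(1), of j])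
        (use j len assms comp in auto)
  qed
  then have "(\<Sum>qs\<in>{qs. length qs = Suc k}. delta_hom k \<omega> qs (map2 component qs xs))
      = (\<Sum>qs\<in>{ps}. delta_hom k \<omega> qs (map2 component qs xs))"
    using assms(3) fin by (intro sum.mono_neutral_right) auto
  then show ?thesis unfolding delta_def using assms(2) eq by simp
qed

end

text \<open>
  Products of linear forms, in degree 2. A form on the even or the odd part is viewed as a form on
  the whole space which vanishes on the other part. With this convention, for even \<open>\<phi>\<close> and odd
  \<open>\<psi>\<close>, the second term of \<open>tensor \<phi> \<psi>\<close> vanishes on pairs (even, odd) and is forced by
  super-skew-symmetry on pairs (odd, even).
\<close>

definition wedge :: "('v \<Rightarrow> complex) \<Rightarrow> ('v \<Rightarrow> complex) \<Rightarrow> 'v list \<Rightarrow> complex"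
  where "wedge \<phi> \<psi> xs = (case xs of [X, Y] \<Rightarrow> \<phi> X * \<psi> Y - \<phi> Y * \<psi> X | _ \<Rightarrow> 0)"

definition symprod :: "('v \<Rightarrow> complex) \<Rightarrow> ('v \<Rightarrow> complex) \<Rightarrow> 'v list \<Rightarrow> complex"
  where "symprod \<phi> \<psi> xs = (case xs of [X, Y] \<Rightarrow> \<phi> X * \<psi> Y + \<phi> Y * \<psi> X | _ \<Rightarrow> 0)"

definition tensor :: "('v \<Rightarrow> complex) \<Rightarrow> ('v \<Rightarrow> complex) \<Rightarrow> 'v list \<Rightarrow> complex"
  where "tensor \<phi> \<psi> xs = (case xs of [X, Y] \<Rightarrow> \<phi> X * \<psi> Y - \<phi> Y * \<psi> X | _ \<Rightarrow> 0)"


section \<open>The three superalgebras\<close>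

text \<open>
  Superalgebras on \<open>complex ^ 'b\<close>, where \<open>'b\<close> enumerates a homogeneous basis, given by the
  parities of the basis vectors \<open>e i\<close> and by the values of bracket and form on pairs of them.
\<close>

abbreviation e :: "'b \<Rightarrow> complex ^ 'b"
  where "e i \<equiv> axis i 1"

definition dual :: "'b \<Rightarrow> complex ^ 'b \<Rightarrow> complex"
  where "dual i v = v $ i"

definition graded_part :: "('b \<Rightarrow> bit) \<Rightarrow> bit \<Rightarrow> (complex ^ 'b) set"
  where "graded_part p x = {v. \<forall>i. p i \<noteq> x \<longrightarrow> v $ i = 0}"

definition extend_bracket ::
    "('b \<Rightarrow> 'b \<Rightarrow> complex ^ 'b) \<Rightarrow> complex ^ 'b \<Rightarrow> complex ^ 'b \<Rightarrow> complex ^ 'b::finite"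
  where "extend_bracket c u v = (\<Sum>i\<in>UNIV. \<Sum>j\<in>UNIV. (u $ i * v $ j) *s c i j)"

definition extend_form ::
    "('b \<Rightarrow> 'b \<Rightarrow> complex) \<Rightarrow> complex ^ 'b \<Rightarrow> complex ^ 'b::finite \<Rightarrow> complex"
  where "extend_form c u v = (\<Sum>i\<in>UNIV. \<Sum>j\<in>UNIV. u $ i * v $ j * c i j)"

datatype b4 = X0 | Y0 | X1 | Y1
datatype b6 = X0 | Y0 | X1 | Y1 | Z1 | T1

lemma UNIV_b4: "UNIV = {b4.X0, b4.Y0, b4.X1, b4.Y1}"
  using b4.exhaust by auto

lemma UNIV_b6: "UNIV = {b6.X0, b6.Y0, b6.X1, b6.Y1, b6.Z1, b6.T1}"
  using b6.exhaust by auto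

instance b4 :: finite
  by standard (simp add: UNIV_b4)

instance b6 :: finite
  by standard (simp add: UNIV_b6)

fun parity4 :: "b4 \<Rightarrow> bit" where
  "parity4 b4.X0 = 0"
| "parity4 b4.Y0 = 0"
| "parity4 b4.X1 = 1"
| "parity4 b4.Y1 = 1"

fun parity6 :: "b6 \<Rightarrow> bit" where
  "parity6 b6.X0 = 0"
| "parity6 b6.Y0 = 0"
| "parity6 b6.X1 = 1"
| "parity6 b6.Y1 = 1"
| "parity6 b6.Z1 = 1"
| "parity6 b6.T1 = 1"

fun form4 :: "b4 \<Rightarrow> b4 \<Rightarrow> complex" where
  "form4 b4.X0 b4.Y0 = 1"
| "form4 b4.Y0 b4.X0 = 1"
| "form4 b4.X1 b4.Y1 = 1"
| "form4 b4.Y1 b4.X1 = - 1"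
| "form4 _ _ = 0"

fun form6 :: "b6 \<Rightarrow> b6 \<Rightarrow> complex" where
  "form6 b6.X0 b6.Y0 = 1"
| "form6 b6.Y0 b6.X0 = 1"
| "form6 b6.X1 b6.Z1 = 1"
| "form6 b6.Z1 b6.X1 = - 1"
| "form6 b6.Y1 b6.T1 = 1"
| "form6 b6.T1 b6.Y1 = - 1"
| "form6 _ _ = 0"

fun bracket41 :: "b4 \<Rightarrow> b4 \<Rightarrow> complex ^ b4" where
  "bracket41 b4.Y1 b4.Y1 = - 2 *s e b4.X0"
| "bracket41 b4.Y0 b4.Y1 = - 2 *s e b4.X1"
| "bracket41 b4.Y1 b4.Y0 = 2 *s e b4.X1"
| "bracket41 _ _ = 0"

fun bracket42 :: "b4 \<Rightarrow> b4 \<Rightarrow> complex ^ b4" where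
  "bracket42 b4.X1 b4.Y1 = e b4.X0"
| "bracket42 b4.Y1 b4.X1 = e b4.X0"
| "bracket42 b4.Y0 b4.X1 = e b4.X1"
| "bracket42 b4.X1 b4.Y0 = - e b4.X1"
| "bracket42 b4.Y0 b4.Y1 = - e b4.Y1"
| "bracket42 b4.Y1 b4.Y0 = e b4.Y1"
| "bracket42 _ _ = 0"

fun bracket6 :: "b6 \<Rightarrow> b6 \<Rightarrow> complex ^ b6" where
  "bracket6 b6.Z1 b6.T1 = - e b6.X0"
| "bracket6 b6.T1 b6.Z1 = - e b6.X0"
| "bracket6 b6.Y0 b6.Z1 = - e b6.Y1"
| "bracket6 b6.Z1 b6.Y0 = e b6.Y1"
| "bracket6 b6.Y0 b6.T1 = - e b6.X1"
| "bracket6 b6.T1 b6.Y0 = e b6.X1"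
| "bracket6 _ _ = 0"

lemma extend_bracket_linear:
  fixes c :: "'b \<Rightarrow> 'b \<Rightarrow> complex ^ 'b::finite"
  shows "Vector_Spaces.linear (*s) (*s) (\<lambda>w. extend_bracket c v w)"
    and "Vector_Spaces.linear (*s) (*s) (\<lambda>w. extend_bracket c w v)"
  unfolding extend_bracket_def
  by (intro Vector_Spaces.linear.intro vec.vector_space_axioms module_hom.intro
      vec.module_axioms module_hom_axioms.intro;
      simp add: vec_eq_iff algebra_simps sum.distrib sum_distrib_left)+

lemma vector_space_complex: "vector_space ((*) :: complex \<Rightarrow> complex \<Rightarrow> complex)"
  by standard (auto simp: algebra_simps)

lemma extend_form_linear:
  fixes c :: "'b \<Rightarrow> 'b::finite \<Rightarrow> complex"
  shows "Vector_Spaces.linear (*s) (*) (\<lambda>w. extend_form c v w)"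
    and "Vector_Spaces.linear (*s) (*) (\<lambda>w. extend_form c w v)"
  unfolding extend_form_def
  by (intro Vector_Spaces.linear.intro vec.vector_space_axioms vector_space_complex module_hom.intro
      vec.module_axioms module_hom_axioms.intro vector_space_complex[THEN module_iff_vector_space[THEN iffD2]];
      simp add: algebra_simps sum.distrib sum_distrib_left)+

lemma graded_part_superspace:
  fixes p :: "'b::finite \<Rightarrow> bit"
  shows "\<exists>A :: (complex ^ 'b) set. finite A \<and> vec.span A = UNIV"
    and "vec.subspace (graded_part p x)"
    and "graded_part p 0 \<inter> graded_part p 1 = {0}"
    and "\<exists>a\<in>graded_part p 0. \<exists>b\<in>graded_part p 1. v = a + b"
proof -
  show "\<exists>A :: (complex ^ 'b) set. finite A \<and> vec.span A = UNIV"
    using vec.finite_Basis vec.span_Basis by blast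
  show "vec.subspace (graded_part p x)"
    by (auto simp: vec.subspace_def graded_part_def)
  show "graded_part p 0 \<inter> graded_part p 1 = {0}"
    by (auto simp: graded_part_def vec_eq_iff) (metis bit_not_one_iff)
  show "\<exists>a\<in>graded_part p 0. \<exists>b\<in>graded_part p 1. v = a + b"
    by (intro bexI[of _ "\<chi> i. if p i = 0 then v $ i else 0"]
        bexI[of _ "\<chi> i. if p i = 1 then v $ i else 0"])
      (auto simp: graded_part_def vec_eq_iff)
qed

lemma all_b4: "(\<forall>i. P i) \<longleftrightarrow> P b4.X0 \<and> P b4.Y0 \<and> P b4.X1 \<and> P b4.Y1"
  by (metis (full_types) b4.exhaust)

lemma all_b6:
  "(\<forall>i. P i) \<longleftrightarrow> P b6.X0 \<and> P b6.Y0 \<and> P b6.X1 \<and> P b6.Y1 \<and> P b6.Z1 \<and> P b6.T1"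
  by (metis (full_types) b6.exhaust)

lemma graded_part4:
  "v \<in> graded_part parity4 x \<longleftrightarrow>
    (x = 0 \<and> v $ b4.X1 = 0 \<and> v $ b4.Y1 = 0) \<or> (x = 1 \<and> v $ b4.X0 = 0 \<and> v $ b4.Y0 = 0)"
  by (cases x) (simp_all add: graded_part_def all_b4)

lemma graded_part6:
  "v \<in> graded_part parity6 x \<longleftrightarrow>
    (x = 0 \<and> v $ b6.X1 = 0 \<and> v $ b6.Y1 = 0 \<and> v $ b6.Z1 = 0 \<and> v $ b6.T1 = 0) \<or>
    (x = 1 \<and> v $ b6.X0 = 0 \<and> v $ b6.Y0 = 0)"
  by (cases x) (simp_all add: graded_part_def all_b6)

lemmas vec_eq_b4 = vec_eq_iff[where 'b = b4, unfolded all_b4]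

lemmas vec_eq_b6 = vec_eq_iff[where 'b = b6, unfolded all_b6]

lemma extend_bracket41:
  "extend_bracket bracket41 u v $ b4.X0 = - 2 * (u $ b4.Y1 * v $ b4.Y1)"
  "extend_bracket bracket41 u v $ b4.Y0 = 0"
  "extend_bracket bracket41 u v $ b4.X1 = 2 * (u $ b4.Y1 * v $ b4.Y0 - u $ b4.Y0 * v $ b4.Y1)"
  "extend_bracket bracket41 u v $ b4.Y1 = 0"
  by (simp_all add: extend_bracket_def UNIV_b4 axis_def algebra_simps)

lemma extend_bracket42:
  "extend_bracket bracket42 u v $ b4.X0 = u $ b4.X1 * v $ b4.Y1 + u $ b4.Y1 * v $ b4.X1"
  "extend_bracket bracket42 u v $ b4.Y0 = 0"
  "extend_bracket bracket42 u v $ b4.X1 = u $ b4.Y0 * v $ b4.X1 - u $ b4.X1 * v $ b4.Y0"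
  "extend_bracket bracket42 u v $ b4.Y1 = u $ b4.Y1 * v $ b4.Y0 - u $ b4.Y0 * v $ b4.Y1"
  by (simp_all add: extend_bracket_def UNIV_b4 axis_def algebra_simps)

lemma extend_bracket6:
  "extend_bracket bracket6 u v $ b6.X0 = - (u $ b6.Z1 * v $ b6.T1 + u $ b6.T1 * v $ b6.Z1)"
  "extend_bracket bracket6 u v $ b6.Y0 = 0"
  "extend_bracket bracket6 u v $ b6.X1 = u $ b6.T1 * v $ b6.Y0 - u $ b6.Y0 * v $ b6.T1"
  "extend_bracket bracket6 u v $ b6.Y1 = u $ b6.Z1 * v $ b6.Y0 - u $ b6.Y0 * v $ b6.Z1"
  "extend_bracket bracket6 u v $ b6.Z1 = 0"
  "extend_bracket bracket6 u v $ b6.T1 = 0"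
  by (simp_all add: extend_bracket_def UNIV_b6 axis_def algebra_simps)

lemma extend_form4:
  "extend_form form4 u v = u $ b4.X0 * v $ b4.Y0 + u $ b4.Y0 * v $ b4.X0
    + u $ b4.X1 * v $ b4.Y1 - u $ b4.Y1 * v $ b4.X1"
  by (simp add: extend_form_def UNIV_b4)

lemma extend_form6:
  "extend_form form6 u v = u $ b6.X0 * v $ b6.Y0 + u $ b6.Y0 * v $ b6.X0
    + u $ b6.X1 * v $ b6.Z1 - u $ b6.Z1 * v $ b6.X1 + u $ b6.Y1 * v $ b6.T1 - u $ b6.T1 * v $ b6.Y1"
  by (simp add: extend_form_def UNIV_b6)

lemma form4_nondegenerate:
  assumes "\<And>w. extend_form form4 v w = 0"
  shows "v = 0"
  using assms[of "e b4.X0"] assms[of "e b4.Y0"] assms[of "e b4.X1"] assms[of "e b4.Y1"]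
  by (simp add: extend_form4 vec_eq_b4 axis_def)

lemma form6_nondegenerate:
  assumes "\<And>w. extend_form form6 v w = 0"
  shows "v = 0"
  using assms[of "e b6.X0"] assms[of "e b6.Y0"] assms[of "e b6.X1"] assms[of "e b6.Y1"]
    assms[of "e b6.Z1"] assms[of "e b6.T1"]
  by (simp add: extend_form6 vec_eq_b6 axis_def)

interpretation g41: quadratic_lie_superalgebra
  "(*s)" "graded_part parity4" "extend_bracket bracket41" "extend_form form4"
proof (intro quadratic_lie_superalgebra.intro lie_superalgebra.intro vec.vector_space_axioms
    lie_superalgebra_axioms.intro quadratic_lie_superalgebra_axioms.intro, goal_cases)
  case (7 X x Y y)
  then show ?case
    by (cases x; cases y; simp add: graded_part4 vec_eq_b4 extend_bracket41)
next
  case (8 X x Y y)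
  then show ?case
    by (cases x; cases y; simp add: graded_part4 vec_eq_b4 extend_bracket41 psign_def)
next
  case (9 X x Y y Z z)
  then show ?case
    by (cases x; cases y; cases z;
        simp add: graded_part4 vec_eq_b4 extend_bracket41 psign_def algebra_simps)
next
  case (12 v)
  then show ?case by (rule form4_nondegenerate)
next
  case (13 X x Y y)
  then show ?case
    by (cases x; cases y; simp add: graded_part4 extend_form4 psign_def)
next
  case (14 X Y Z)
  then show ?case by (simp add: extend_bracket41 extend_form4 algebra_simps)
next
  case (15 X Y)
  then show ?case by (simp add: graded_part4 extend_form4)
qed (rule graded_part_superspace extend_bracket_linear extend_form_linear)+

interpretation g42: quadratic_lie_superalgebra
  "(*s)" "graded_part parity4" "extend_bracket bracket42" "extend_form form4"
proof (intro quadratic_lie_superalgebra.intro lie_superalgebra.intro vec.vector_space_axioms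
    lie_superalgebra_axioms.intro quadratic_lie_superalgebra_axioms.intro, goal_cases)
  case (7 X x Y y)
  then show ?case
    by (cases x; cases y; simp add: graded_part4 vec_eq_b4 extend_bracket42)
next
  case (8 X x Y y)
  then show ?case
    by (cases x; cases y; simp add: graded_part4 vec_eq_b4 extend_bracket42 psign_def)
next
  case (9 X x Y y Z z)
  then show ?case
    by (cases x; cases y; cases z;
        simp add: graded_part4 vec_eq_b4 extend_bracket42 psign_def algebra_simps)
next
  case (12 v)
  then show ?case by (rule form4_nondegenerate)
next
  case (13 X x Y y)
  then show ?case
    by (cases x; cases y; simp add: graded_part4 extend_form4 psign_def)
next
  case (14 X Y Z)
  then show ?case by (simp add: extend_bracket42 extend_form4 algebra_simps)
next
  case (15 X Y)
  then show ?case by (simp add: graded_part4 extend_form4)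
qed (rule graded_part_superspace extend_bracket_linear extend_form_linear)+

interpretation g6: quadratic_lie_superalgebra
  "(*s)" "graded_part parity6" "extend_bracket bracket6" "extend_form form6"
proof (intro quadratic_lie_superalgebra.intro lie_superalgebra.intro vec.vector_space_axioms
    lie_superalgebra_axioms.intro quadratic_lie_superalgebra_axioms.intro, goal_cases)
  case (7 X x Y y)
  then show ?case
    by (cases x; cases y; simp add: graded_part6 vec_eq_b6 extend_bracket6)
next
  case (8 X x Y y)
  then show ?case
    by (cases x; cases y; simp add: graded_part6 vec_eq_b6 extend_bracket6 psign_def)
next
  case (9 X x Y y Z z)
  then show ?case
    by (cases x; cases y; cases z;
        simp add: graded_part6 vec_eq_b6 extend_bracket6 psign_def algebra_simps)
next
  case (12 v)
  then show ?case by (rule form6_nondegenerate)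
next
  case (13 X x Y y)
  then show ?case
    by (cases x; cases y; simp add: graded_part6 extend_form6 psign_def)
next
  case (14 X Y Z)
  then show ?case by (simp add: extend_bracket6 extend_form6 algebra_simps)
next
  case (15 X Y)
  then show ?case by (simp add: graded_part6 extend_form6)
qed (rule graded_part_superspace extend_bracket_linear extend_form_linear)+

end

theory Submission
  imports Defs
begin

text \<open>
  A 2-cocycle is determined by its values on pairs of basis vectors. Evaluating the cocycle condition
  on suitable triples of basis vectors cuts these values down to those of the listed
  representatives and those of the coboundaries, since the differential of a linear form \<open>f\<close> is
  \<open>- f\<close> composed with the bracket.
\<close>

section \<open>Cohomology as a quotient of the space of cocycles\<close>

text \<open>Makes the library notions \<open>subspace\<close> and \<open>span\<close> available for
  sets of cochains, so that the quotient can be handled through representatives.\<close>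

interpretation forms: vector_space "scale_form :: complex \<Rightarrow> ('v list \<Rightarrow> complex) \<Rightarrow> _"
  by standard (auto simp: scale_form_def fun_eq_iff algebra_simps)

context lie_superalgebra
begin

section \<open>Linearity of the differential and the subspaces it defines\<close>

lemma linear_form_iff:
  "Vector_Spaces.linear scale (*) f \<longleftrightarrow>
    (\<forall>x y. f (x + y) = f x + f y) \<and> (\<forall>c x. f (c *\<^sub>V x) = c * f x)"
  using vector_space_axioms vector_space_complex by (auto simp: Vector_Spaces.linear_iff)

lemma cochainsD:
  assumes "\<omega> \<in> cochains n"
  shows "length xs \<noteq> n \<Longrightarrow> \<omega> xs = 0"
    and "length us + 1 + length vs = n \<Longrightarrow> Vector_Spaces.linear scale (*) (\<lambda>v. \<omega> (us @ [v] @ vs))"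
    and "length us + 2 + length vs = n \<Longrightarrow> X \<in> g x \<Longrightarrow> Y \<in> g y \<Longrightarrow>
      \<omega> (us @ [X, Y] @ vs) = - psign (x * y) * \<omega> (us @ [Y, X] @ vs)"
  using assms unfolding cochains_def by blast+

lemma cochainsI:
  assumes "\<And>xs. length xs \<noteq> n \<Longrightarrow> \<omega> xs = 0"
    and "\<And>us vs. length us + 1 + length vs = n \<Longrightarrow>
      Vector_Spaces.linear scale (*) (\<lambda>v. \<omega> (us @ [v] @ vs))"
    and "\<And>us vs X Y x y. length us + 2 + length vs = n \<Longrightarrow> X \<in> g x \<Longrightarrow> Y \<in> g y \<Longrightarrow>
      \<omega> (us @ [X, Y] @ vs) = - psign (x * y) * \<omega> (us @ [Y, X] @ vs)"
  shows "\<omega> \<in> cochains n"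
  using assms unfolding cochains_def by blast

lemma subspace_cochains: "forms.subspace (cochains n)"
  unfolding forms.subspace_def
proof (intro conjI ballI allI)
  show "0 \<in> cochains n"
    by (rule cochainsI) (simp_all add: linear_form_iff)
next
  fix \<alpha> \<beta> assume c: "\<alpha> \<in> cochains n" "\<beta> \<in> cochains n"
  show "\<alpha> + \<beta> \<in> cochains n"
  proof (rule cochainsI, goal_cases)
    case (2 us vs)
    then show ?case using c[THEN cochainsD(2), of us vs]
      by (simp add: linear_form_iff algebra_simps)
  next
    case (3 us vs X Y x y)
    then show ?case using c[THEN cochainsD(3), of us vs X x Y y]
      by (simp add: algebra_simps)
  qed (simp add: c[THEN cochainsD(1)])
next
  fix a \<alpha> assume c: "\<alpha> \<in> cochains n"
  show "scale_form a \<alpha> \<in> cochains n"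
  proof (rule cochainsI, goal_cases)
    case (2 us vs)
    then show ?case using cochainsD(2)[OF c, of us vs]
      by (simp add: linear_form_iff scale_form_def algebra_simps)
  next
    case (3 us vs X Y x y)
    then show ?case using cochainsD(3)[OF c, of us vs X x Y y]
      by (simp add: scale_form_def)
  qed (simp add: scale_form_def cochainsD(1)[OF c])
qed

lemma delta_add: "delta k (\<alpha> + \<beta>) = delta k \<alpha> + delta k \<beta>"
  by (auto simp: delta_def delta_hom_def fun_eq_iff algebra_simps sum.distrib)

lemma delta_scale: "delta k (scale_form c \<alpha>) = scale_form c (delta k \<alpha>)"
  by (auto simp: delta_def delta_hom_def scale_form_def fun_eq_iff sum_distrib_left algebra_simps)

lemma delta_zero: "delta k 0 = 0"
  using delta_scale[of k 0 0] by (simp add: scale_form_def zero_fun_def)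

lemma subspace_cocycles: "forms.subspace (cocycles k)"
  using subspace_cochains[of k] unfolding forms.subspace_def cocycles_def
  by (auto simp: delta_add delta_scale delta_zero)

lemma subspace_coboundaries: "forms.subspace (coboundaries k)"
proof (cases k)
  case (Suc n)
  have "module_hom scale_form scale_form (delta n)"
    by unfold_locales (simp_all add: delta_add delta_scale)
  then show ?thesis
    using module_hom.subspace_image subspace_cochains[of n] Suc by fastforce
qed simp

section \<open>Arithmetic of cohomology classes as cosets\<close>

lemma cohom_class_eq_iff: "cohom_class k \<alpha> = cohom_class k \<beta> \<longleftrightarrow> \<alpha> - \<beta> \<in> coboundaries k"
proof
  assume "cohom_class k \<alpha> = cohom_class k \<beta>"
  moreover have "\<alpha> \<in> cohom_class k \<alpha>"
    using forms.subspace_0[OF subspace_coboundaries] by (simp add: cohom_class_def)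
  ultimately show "\<alpha> - \<beta> \<in> coboundaries k" by (simp add: cohom_class_def)
next
  assume d: "\<alpha> - \<beta> \<in> coboundaries k"
  have "\<eta> - \<alpha> \<in> coboundaries k \<longleftrightarrow> \<eta> - \<beta> \<in> coboundaries k" for \<eta>
    using forms.subspace_add[OF subspace_coboundaries _ d, of "\<eta> - \<alpha>"]
      forms.subspace_diff[OF subspace_coboundaries _ d, of "\<eta> - \<beta>"] by auto
  then show "cohom_class k \<alpha> = cohom_class k \<beta>" by (simp add: cohom_class_def)
qed

lemma H_add_class: "H_add (cohom_class k \<alpha>) (cohom_class k \<beta>) = cohom_class k (\<alpha> + \<beta>)"
proof (intro equalityI subsetI)
  fix \<eta> assume "\<eta> \<in> H_add (cohom_class k \<alpha>) (cohom_class k \<beta>)"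
  then obtain a b where \<eta>: "\<eta> = a + b" "a - \<alpha> \<in> coboundaries k" "b - \<beta> \<in> coboundaries k"
    by (auto simp: H_add_def cohom_class_def)
  then show "\<eta> \<in> cohom_class k (\<alpha> + \<beta>)"
    using forms.subspace_add[OF subspace_coboundaries \<eta>(2,3)]
    by (simp add: cohom_class_def algebra_simps)
next
  fix \<eta> assume "\<eta> \<in> cohom_class k (\<alpha> + \<beta>)"
  \<comment> \<open>The first summand absorbs the whole coboundary.\<close>
  then have "\<eta> = (\<eta> - \<beta>) + \<beta>" "\<eta> - \<beta> \<in> cohom_class k \<alpha>" "\<beta> \<in> cohom_class k \<beta>"
    using forms.subspace_0[OF subspace_coboundaries]
    by (auto simp: cohom_class_def algebra_simps)
  then show "\<eta> \<in> H_add (cohom_class k \<alpha>) (cohom_class k \<beta>)"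
    unfolding H_add_def by blast
qed

lemma H_scale_class: "H_scale k c (cohom_class k \<alpha>) = cohom_class k (scale_form c \<alpha>)"
proof (intro equalityI subsetI)
  fix \<eta> assume "\<eta> \<in> H_scale k c (cohom_class k \<alpha>)"
  then obtain a b where \<eta>: "\<eta> = scale_form c a + b" "a - \<alpha> \<in> coboundaries k"
      "b \<in> coboundaries k"
    by (auto simp: H_scale_def cohom_class_def)
  have "scale_form c (a - \<alpha>) + b \<in> coboundaries k"
    using \<eta> subspace_coboundaries by (intro forms.subspace_add forms.subspace_scale)
  then show "\<eta> \<in> cohom_class k (scale_form c \<alpha>)"
    using \<eta>(1) by (simp add: cohom_class_def forms.scale_right_diff_distrib algebra_simps)
next
  fix \<eta> assume "\<eta> \<in> cohom_class k (scale_form c \<alpha>)"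
  then have "\<eta> = scale_form c \<alpha> + (\<eta> - scale_form c \<alpha>)" "\<alpha> \<in> cohom_class k \<alpha>"
      "\<eta> - scale_form c \<alpha> \<in> coboundaries k"
    using forms.subspace_0[OF subspace_coboundaries]
    by (auto simp: cohom_class_def algebra_simps)
  then show "\<eta> \<in> H_scale k c (cohom_class k \<alpha>)"
    unfolding H_scale_def by blast
qed

lemma H_subspace_H: "H_subspace k (H k)"
  using subspace_cocycles[of k] unfolding H_subspace_def H_def H_zero_def forms.subspace_def
  by (auto simp: H_add_class H_scale_class)

text \<open>Classes depend linearly on representatives, so a subspace of \<open>H k\<close>
  containing the classes of \<open>S\<close> contains those of \<open>forms.span S\<close>, which by
  \<open>cover\<close> are all of them. Conversely \<open>H k\<close> is itself such a subspace,
  because \<open>S\<close> consists of cocycles.\<close>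

lemma H_eq_H_span:
  assumes "S \<subseteq> cocycles k"
    and cover: "\<And>\<omega>. \<omega> \<in> cocycles k \<Longrightarrow> \<exists>\<eta>\<in>forms.span S. \<omega> - \<eta> \<in> coboundaries k"
  shows "H k = H_span k (cohom_class k ` S)"
proof
  \<comment> \<open>Induction over the span: each step adds a multiple of a generator, which
    \<open>H_scale\<close> and \<open>H_add\<close> mirror on classes.\<close>
  have mem: "cohom_class k \<eta> \<in> W"
    if W: "H_subspace k W" "cohom_class k ` S \<subseteq> W" and "\<eta> \<in> forms.span S" for W \<eta>
    using that(3)
  proof (induction rule: forms.span_induct_alt)
    case base
    then show ?case using W(1) by (auto simp: H_subspace_def H_zero_def zero_fun_def)
  next
    case (step c \<alpha> \<beta>)
    then have "H_add (H_scale k c (cohom_class k \<alpha>)) (cohom_class k \<beta>) \<in> W"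
      using W unfolding H_subspace_def by blast
    then show ?case by (simp add: H_add_class H_scale_class plus_fun_def)
  qed
  have rep: "\<exists>\<eta>\<in>forms.span S. a = cohom_class k \<eta>" if a: "a \<in> H k" for a
  proof -
    obtain \<omega> where "\<omega> \<in> cocycles k" "a = cohom_class k \<omega>"
      using a by (auto simp: H_def)
    then show ?thesis using cover by (metis cohom_class_eq_iff)
  qed
  show "H k \<subseteq> H_span k (cohom_class k ` S)"
    unfolding H_span_def hull_def using rep mem by (intro subsetI InterI) auto
  show "H_span k (cohom_class k ` S) \<subseteq> H k"
    unfolding H_span_def using assms(1) by (intro hull_minimal H_subspace_H) (auto simp: H_def)
qed


section \<open>Cochains and differentials in low degrees\<close>

text \<open>Two candidates differ by a vector lying in both parts of the grading, hence by
  zero.\<close>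

lemma component_eqI:
  assumes "a \<in> g x" "v - a \<in> g (x + 1)"
  shows "component x v = a"
  unfolding component_def
proof (rule the_equality)
  fix b assume b: "b \<in> g x \<and> v - b \<in> g (x + 1)"
  have "b - a \<in> g x" using assms b subspace_diff subspace_part by blast
  moreover have "b - a \<in> g (x + 1)"
    using subspace_diff[OF subspace_part[of "x + 1"] assms(2), of "v - b"] b by simp
  ultimately have "b - a \<in> g 0 \<inter> g 1" by (cases x) auto
  then show "b = a" using parts_disjoint by auto
qed (use assms in simp)

lemma component_mem: "component x v \<in> g x"
  and component_sum: "component 0 v + component 1 v = v"
proof -
  obtain a b where v: "v = a + b" "a \<in> g 0" "b \<in> g 1" using parts_span by blast
  then have "component 0 v = a" "component 1 v = b"
    by (auto intro!: component_eqI)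
  with v show "component x v \<in> g x" "component 0 v + component 1 v = v"
    by (cases x; simp)+
qed

text \<open>The super-skew-symmetry clause is vacuous here, since it speaks of lists of length at
  least 2.\<close>

lemma cochains_1_iff:
  "\<omega> \<in> cochains 1 \<longleftrightarrow> (\<forall>xs. length xs \<noteq> 1 \<longrightarrow> \<omega> xs = 0) \<and>
    Vector_Spaces.linear scale (*) (\<lambda>v. \<omega> [v])"
  by (auto simp: cochains_def)

lemma cochains_2_iff:
  "\<omega> \<in> cochains 2 \<longleftrightarrow> (\<forall>xs. length xs \<noteq> 2 \<longrightarrow> \<omega> xs = 0) \<and>
    (\<forall>v. Vector_Spaces.linear scale (*) (\<lambda>w. \<omega> [w, v])) \<and>
    (\<forall>v. Vector_Spaces.linear scale (*) (\<lambda>w. \<omega> [v, w])) \<and>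
    (\<forall>X Y x y. X \<in> g x \<longrightarrow> Y \<in> g y \<longrightarrow> \<omega> [X, Y] = - psign (x * y) * \<omega> [Y, X])"
proof -
  \<comment> \<open>The varying argument is either the first or the second. An arbitrary
    \<open>P\<close> lets this equivalence, like the next one, rewrite the clauses of
    \<open>cochains_def\<close>.\<close>
  have 1: "(\<forall>us vs. length us + 1 + length vs = 2 \<longrightarrow> P us vs) \<longleftrightarrow>
      (\<forall>v. P [] [v]) \<and> (\<forall>v. P [v] [])" for P :: "'v list \<Rightarrow> 'v list \<Rightarrow> bool"
  proof (intro iffI conjI allI impI)
    fix us vs :: "'v list"
    assume "(\<forall>v. P [] [v]) \<and> (\<forall>v. P [v] [])" "length us + 1 + length vs = 2"
    then show "P us vs" by (cases us; cases vs) auto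
  qed simp_all
  have 2: "(\<forall>us vs X Y x y. length us + 2 + length vs = 2 \<longrightarrow> P us vs X Y x y) \<longleftrightarrow>
      (\<forall>X Y x y. P [] [] X Y x y)"
    for P :: "'v list \<Rightarrow> 'v list \<Rightarrow> 'v \<Rightarrow> 'v \<Rightarrow> bit \<Rightarrow> bit \<Rightarrow> bool"
    by simp
  show ?thesis unfolding cochains_def mem_Collect_eq 1 2 by simp
qed

text \<open>The formula is antisymmetric, which is the wrong sign only for two odd arguments; there
  both forms vanish.\<close>

lemma wedge_cochain:
  assumes "Vector_Spaces.linear scale (*) \<phi>" "Vector_Spaces.linear scale (*) \<psi>"
    and "\<And>v. v \<in> g 1 \<Longrightarrow> \<phi> v = 0" "\<And>v. v \<in> g 1 \<Longrightarrow> \<psi> v = 0"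
  shows "wedge \<phi> \<psi> \<in> cochains 2"
  unfolding cochains_2_iff
proof (intro conjI allI impI)
  show "wedge \<phi> \<psi> [X, Y] = - psign (x * y) * wedge \<phi> \<psi> [Y, X]"
    if "X \<in> g x" "Y \<in> g y" for X Y x y
    using that assms(3,4) by (cases x; cases y; simp add: wedge_def psign_def)
qed (use assms(1,2) in \<open>auto simp: linear_form_iff wedge_def algebra_simps split: list.split\<close>)

text \<open>The symmetric sign is right for two odd arguments, and any even argument kills both
  terms.\<close>

lemma symprod_cochain:
  assumes "Vector_Spaces.linear scale (*) \<phi>" "Vector_Spaces.linear scale (*) \<psi>"
    and "\<And>v. v \<in> g 0 \<Longrightarrow> \<phi> v = 0" "\<And>v. v \<in> g 0 \<Longrightarrow> \<psi> v = 0"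
  shows "symprod \<phi> \<psi> \<in> cochains 2"
  unfolding cochains_2_iff
proof (intro conjI allI impI)
  show "symprod \<phi> \<psi> [X, Y] = - psign (x * y) * symprod \<phi> \<psi> [Y, X]"
    if "X \<in> g x" "Y \<in> g y" for X Y x y
    using that assms(3,4) by (cases x; cases y; simp add: symprod_def psign_def)
qed (use assms(1,2) in \<open>auto simp: linear_form_iff symprod_def algebra_simps split: list.split\<close>)

text \<open>As for \<open>wedge\<close>, antisymmetry is wrong only on two odd arguments, and there
  \<open>\<phi>\<close> alone annihilates both terms.\<close>

lemma tensor_cochain:
  assumes "Vector_Spaces.linear scale (*) \<phi>" "Vector_Spaces.linear scale (*) \<psi>"
    and "\<And>v. v \<in> g 1 \<Longrightarrow> \<phi> v = 0" "\<And>v. v \<in> g 0 \<Longrightarrow> \<psi> v = 0"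
  shows "tensor \<phi> \<psi> \<in> cochains 2"
  unfolding cochains_2_iff
proof (intro conjI allI impI)
  show "tensor \<phi> \<psi> [X, Y] = - psign (x * y) * tensor \<phi> \<psi> [Y, X]"
    if "X \<in> g x" "Y \<in> g y" for X Y x y
    using that assms(3,4) by (cases x; cases y; simp add: tensor_def psign_def)
qed (use assms(1,2) in \<open>auto simp: linear_form_iff tensor_def algebra_simps split: list.split\<close>)

text \<open>Only \<open>s = 1\<close>, \<open>r = 0\<close> contributes, with sign -1 whatever the
  parities, so the four homogeneous summands recombine by bilinearity of the bracket.\<close>

lemma delta_1:
  assumes "\<omega> \<in> cochains 1"
  shows "delta 1 \<omega> = (\<lambda>xs. case xs of [X, Y] \<Rightarrow> - \<omega> [\<lbrakk>X, Y\<rbrakk>] | _ \<Rightarrow> 0)"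
proof
  fix xs
  have add: "\<omega> [v + w] = \<omega> [v] + \<omega> [w]" for v w
    using assms unfolding cochains_1_iff linear_form_iff by blast
  have br: "\<lbrakk>u, v + w\<rbrakk> = \<lbrakk>u, v\<rbrakk> + \<lbrakk>u, w\<rbrakk>" "\<lbrakk>v + w, u\<rbrakk> = \<lbrakk>v, u\<rbrakk> + \<lbrakk>w, u\<rbrakk>" for u v w
    using bracket_linear_left bracket_linear_right by (auto simp: Vector_Spaces.linear_iff)
  have ps: "{ps :: bit list. length ps = Suc 1} = {[0,0], [0,1], [1,0], [1,1]}"
    by (auto simp: length_Suc_conv)
  have "delta 1 \<omega> [X, Y] = - \<omega> [\<lbrakk>X, Y\<rbrakk>]" for X Y
  proof -
    have "\<omega> [\<lbrakk>X, Y\<rbrakk>] =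
        \<omega> [\<lbrakk>component 0 X + component 1 X, component 0 Y + component 1 Y\<rbrakk>]"
      by (simp add: component_sum)
    then show ?thesis
      unfolding delta_def ps by (simp add: delta_hom_def psign_def br add)
  qed
  moreover have "delta 1 \<omega> xs = 0" if "\<nexists>X Y. xs = [X, Y]"
    using that by (auto simp: delta_def length_Suc_conv)
  ultimately show "delta 1 \<omega> xs = (case xs of [X, Y] \<Rightarrow> - \<omega> [\<lbrakk>X, Y\<rbrakk>] | _ \<Rightarrow> 0)"
    by (auto split: list.split)
qed

text \<open>The three terms belong to the pairs \<open>(r, s)\<close> equal to (0,1), (0,2) and
  (1,2); only for (0,2) is there an entry in between to produce a parity sign.\<close>

lemma delta_hom_2:
  "delta_hom 2 \<omega> [x, y, z] [X, Y, Z] =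
    - \<omega> [\<lbrakk>X, Y\<rbrakk>, Z] + psign (y * z) * \<omega> [\<lbrakk>X, Z\<rbrakk>, Y] + \<omega> [X, \<lbrakk>Y, Z\<rbrakk>]"
  by (simp add: delta_hom_def psign_def numeral_2_eq_2 atMost_Suc lessThan_Suc
      greaterThanLessThan_def)

text \<open>On homogeneous arguments \<open>delta\<close> is the single term
  \<open>delta_hom\<close>; on general ones it is a sum of such terms at homogeneous components,
  each of which vanishes by the condition.\<close>

lemma cocycles_2_iff:
  "\<omega> \<in> cocycles 2 \<longleftrightarrow> \<omega> \<in> cochains 2 \<and>
    (\<forall>X Y Z x y z. X \<in> g x \<longrightarrow> Y \<in> g y \<longrightarrow> Z \<in> g z \<longrightarrow>
      - \<omega> [\<lbrakk>X, Y\<rbrakk>, Z] + psign (y * z) * \<omega> [\<lbrakk>X, Z\<rbrakk>, Y] + \<omega> [X, \<lbrakk>Y, Z\<rbrakk>] = 0)"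
  (is "_ \<longleftrightarrow> _ \<and> ?eqs")
proof -
  have "delta 2 \<omega> = 0 \<longleftrightarrow> ?eqs" if \<omega>: "\<omega> \<in> cochains 2"
  proof
    assume 0: "delta 2 \<omega> = 0"
    show ?eqs
    proof (intro allI impI)
      fix X Y Z x y z assume mem: "X \<in> g x" "Y \<in> g y" "Z \<in> g z"
      have "delta 2 \<omega> [X, Y, Z] = delta_hom 2 \<omega> [x, y, z] [X, Y, Z]"
        by (rule delta_homogeneous[OF \<omega>])
          (use mem in \<open>auto simp: nth_Cons numeral_2_eq_2 split: nat.split\<close>)
      then show "- \<omega> [\<lbrakk>X, Y\<rbrakk>, Z] + psign (y * z) * \<omega> [\<lbrakk>X, Z\<rbrakk>, Y] + \<omega> [X, \<lbrakk>Y, Z\<rbrakk>] = 0"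
        using 0 by (simp add: delta_hom_2)
    qed
  next
    assume eqs: ?eqs
    have "delta_hom 2 \<omega> ps (map2 component ps xs) = 0"
      if len: "length ps = Suc 2" "length xs = Suc 2" for ps xs
    proof -
      obtain x y z X Y Z where [simp]: "ps = [x, y, z]" "xs = [X, Y, Z]"
        using len by (auto simp: length_Suc_conv numeral_2_eq_2)
      have "map2 component ps xs = [component x X, component y Y, component z Z]" by simp
      then show ?thesis using eqs component_mem by (simp only: delta_hom_2 \<open>ps = _\<close>) blast
    qed
    then show "delta 2 \<omega> = 0" by (auto simp: delta_def fun_eq_iff)
  qed
  then show ?thesis unfolding cocycles_def by blast
qed

lemma cocycles_2I:
  assumes "\<omega> \<in> cochains 2"
    and "\<And>X Y Z x y z. X \<in> g x \<Longrightarrow> Y \<in> g y \<Longrightarrow> Z \<in> g z \<Longrightarrow>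
      - \<omega> [\<lbrakk>X, Y\<rbrakk>, Z] + psign (y * z) * \<omega> [\<lbrakk>X, Z\<rbrakk>, Y] + \<omega> [X, \<lbrakk>Y, Z\<rbrakk>] = 0"
  shows "\<omega> \<in> cocycles 2"
  using assms unfolding cocycles_2_iff by blast

lemma coboundaries_2I:
  assumes "Vector_Spaces.linear scale (*) f"
  shows "(\<lambda>xs. case xs of [X, Y] \<Rightarrow> f \<lbrakk>X, Y\<rbrakk> | _ \<Rightarrow> 0) \<in> coboundaries 2"
proof -
  \<comment> \<open>The minus sign cancels the one in \<open>delta_1\<close>.\<close>
  define \<omega> where "\<omega> xs = (case xs of [X] \<Rightarrow> - f X | _ \<Rightarrow> 0)" for xs
  have \<omega>: "\<omega> \<in> cochains 1"
    using assms unfolding cochains_1_iff linear_form_iff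
    by (auto simp: \<omega>_def length_Suc_conv split: list.split)
  have "(\<lambda>xs. case xs of [X, Y] \<Rightarrow> f \<lbrakk>X, Y\<rbrakk> | _ \<Rightarrow> 0) = delta 1 \<omega>"
    unfolding delta_1[OF \<omega>] by (simp add: \<omega>_def)
  then show ?thesis using \<omega> by (simp add: numeral_2_eq_2)
qed

text \<open>Values on pairs decide, because both cochains vanish on lists of any other length.
  Comparing classes thus amounts to finding a suitable \<open>f\<close>.\<close>

lemma cocycles_2_diffI:
  assumes "\<omega> \<in> cocycles 2" "\<eta> \<in> cocycles 2" "Vector_Spaces.linear scale (*) f"
    and "\<And>X Y. \<omega> [X, Y] = \<eta> [X, Y] + f \<lbrakk>X, Y\<rbrakk>"
  shows "\<omega> - \<eta> \<in> coboundaries 2"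
proof -
  have "\<omega> xs = 0" "\<eta> xs = 0" if "length xs \<noteq> 2" for xs
    using assms(1,2) cochainsD(1) that unfolding cocycles_def by blast+
  then have "\<omega> - \<eta> = (\<lambda>xs. case xs of [X, Y] \<Rightarrow> f \<lbrakk>X, Y\<rbrakk> | _ \<Rightarrow> 0)"
    using assms(4) by (auto simp: fun_eq_iff split: list.split)
  then show ?thesis using coboundaries_2I[OF assms(3)] by simp
qed

end

section \<open>Forms and cocycle conditions in coordinates\<close>

lemma linear_form_expansion:
  fixes f :: "complex ^ 'b::finite \<Rightarrow> complex"
  assumes "Vector_Spaces.linear (*s) (*) f"
  shows "f v = (\<Sum>i\<in>UNIV. v $ i * f (e i))"
proof -
  interpret Vector_Spaces.linear "(*s)" "(*)" f by fact
  have "f v = f (\<Sum>i\<in>UNIV. v $ i *s e i)" by (simp add: basis_expansion)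
  then show ?thesis by (simp add: sum scale)
qed

lemma bilinear_form_expansion:
  fixes \<omega> :: "(complex ^ 'b::finite) list \<Rightarrow> complex"
  assumes "\<And>v. Vector_Spaces.linear (*s) (*) (\<lambda>w. \<omega> [w, v])"
    and "\<And>v. Vector_Spaces.linear (*s) (*) (\<lambda>w. \<omega> [v, w])"
  shows "\<omega> [u, v] = (\<Sum>i\<in>UNIV. \<Sum>j\<in>UNIV. u $ i * v $ j * \<omega> [e i, e j])"
  by (subst linear_form_expansion[OF assms(1)], subst linear_form_expansion[OF assms(2)])
    (simp add: sum_distrib_left algebra_simps)

lemma extend_bracket_axis: "extend_bracket c (e i) (e j) = c i j"
proof -
  have "(e i $ k * e j $ l) *s c k l = (if k = i then if l = j then c i j else 0 else 0)" for k l
    by (auto simp: axis_def)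
  then have "(\<Sum>l\<in>UNIV. (e i $ k * e j $ l) *s c k l) = (if k = i then c i j else 0)" for k
    by simp
  then show ?thesis by (simp add: extend_bracket_def)
qed

lemma axis_mem_graded_part: "e i \<in> graded_part p (p i)"
  by (auto simp: graded_part_def axis_def)

text \<open>Skew-symmetry at an even basis vector paired with itself reads \<open>a = - a\<close>;
  this turns it into vanishing.\<close>

lemma complex_eq_uminus_iff: "a = - a \<longleftrightarrow> a = 0" for a :: complex
  by (simp add: complex_eq_iff)

text \<open>Taking the algebra as the hypothesis \<open>L\<close> gives facts about an arbitrary
  basis and arbitrary structure constants \<open>c\<close>, which then serve all three
  algebras.\<close>

lemma
  fixes p :: "'b::finite \<Rightarrow> bit"
  assumes L: "lie_superalgebra (*s) (graded_part p) (extend_bracket c)"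
    and \<omega>: "\<omega> \<in> lie_superalgebra.cocycles (*s) (graded_part p) (extend_bracket c) 2"
  shows cocycle_basis_skew: "\<omega> [e i, e j] = - psign (p i * p j) * \<omega> [e j, e i]"
    and cocycle_basis_closed:
      "- \<omega> [c i j, e k] + psign (p j * p k) * \<omega> [c i k, e j] + \<omega> [e i, c j k] = 0"
    and cocycle_simps: "\<omega> [0, v] = 0" "\<omega> [v, 0] = 0" "\<omega> [- u, v] = - \<omega> [u, v]"
      "\<omega> [v, - u] = - \<omega> [v, u]" "\<omega> [a *s u, v] = a * \<omega> [u, v]" "\<omega> [v, a *s u] = a * \<omega> [v, u]"
    and cocycle_expansion: "\<omega> [u, v] = (\<Sum>i\<in>UNIV. \<Sum>j\<in>UNIV. u $ i * v $ j * \<omega> [e i, e j])"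
proof -
  interpret lie_superalgebra "(*s)" "graded_part p" "extend_bracket c" by (rule L)
  have ch: "\<omega> \<in> cochains 2" using \<omega> by (simp add: cocycles_2_iff)
  have lin: "Vector_Spaces.linear (*s) (*) (\<lambda>w. \<omega> [w, v])"
      "Vector_Spaces.linear (*s) (*) (\<lambda>w. \<omega> [v, w])" for v
    using cochainsD(2)[OF ch, of "[]" "[v]"] cochainsD(2)[OF ch, of "[v]" "[]"] by simp_all
  show "\<omega> [e i, e j] = - psign (p i * p j) * \<omega> [e j, e i]"
    using ch axis_mem_graded_part[of _ p] unfolding cochains_2_iff by blast
  have "- \<omega> [extend_bracket c (e i) (e j), e k] +
      psign (p j * p k) * \<omega> [extend_bracket c (e i) (e k), e j] +
      \<omega> [e i, extend_bracket c (e j) (e k)] = 0"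
    using \<omega> axis_mem_graded_part[of _ p] unfolding cocycles_2_iff by blast
  then show "- \<omega> [c i j, e k] + psign (p j * p k) * \<omega> [c i k, e j] + \<omega> [e i, c j k] = 0"
    by (simp add: extend_bracket_axis)
  show scale: "\<omega> [a *s u, v] = a * \<omega> [u, v]" "\<omega> [v, a *s u] = a * \<omega> [v, u]" for a u v
    using lin by (auto simp: linear_form_iff)
  \<comment> \<open>Zero and negation are scaling by 0 and by -1.\<close>
  show "\<omega> [0, v] = 0" "\<omega> [v, 0] = 0" "\<omega> [- u, v] = - \<omega> [u, v]" "\<omega> [v, - u] = - \<omega> [v, u]"
    using scale(1)[of 0 0 v] scale(2)[of v 0 0]
      scale(1)[of "- 1" u v] scale(2)[of v "- 1" u]
    by (simp_all add: vec.scale_minus_left)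
  show "\<omega> [u, v] = (\<Sum>i\<in>UNIV. \<Sum>j\<in>UNIV. u $ i * v $ j * \<omega> [e i, e j])"
    by (rule bilinear_form_expansion) (rule lin)+
qed

section \<open>The three algebras\<close>

lemmas form_defs = wedge_def symprod_def tensor_def scale_form_def dual_def

lemma linear_dual: "Vector_Spaces.linear (*s) (*) (dual i)"
  by (simp add: Vector_Spaces.linear_iff vec.vector_space_axioms vector_space_complex dual_def)

lemma dual_graded_part: "v \<in> graded_part p x \<Longrightarrow> p i \<noteq> x \<Longrightarrow> dual i v = 0"
  by (simp add: graded_part_def dual_def)

text \<open>No bracket has a \<open>Y0\<close> coordinate, and its \<open>X1\<close> coordinate
  pairs a \<open>Y0\<close> with a \<open>Y1\<close>. So the tensor is tested only on basis triples
  with two \<open>Y0\<close>, where skewness cancels the terms. Both parts of the second form are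
  tested only on one \<open>Y0\<close> and two \<open>Y1\<close>, and the factor 2 balances
  them.\<close>

lemma cocycles41:
  "tensor (dual b4.Y0) (dual b4.X1) \<in> g41.cocycles 2"
  "symprod (dual b4.X1) (dual b4.Y1) - scale_form 2 (wedge (dual b4.X0) (dual b4.Y0))
    \<in> g41.cocycles 2"
proof -
  note cochains = forms.subspace_diff[OF g41.subspace_cochains]
    forms.subspace_scale[OF g41.subspace_cochains]
    g41.tensor_cochain g41.symprod_cochain g41.wedge_cochain linear_dual
  show "tensor (dual b4.Y0) (dual b4.X1) \<in> g41.cocycles 2"
  proof (rule g41.cocycles_2I, goal_cases)
    case (2 X Y Z x y z)
    then show ?case
      by (cases x; cases y; cases z;
        simp add: graded_part4 psign_def form_defs extend_bracket41 algebra_simps)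
  qed (intro cochains; simp add: dual_graded_part)
  show "symprod (dual b4.X1) (dual b4.Y1) - scale_form 2 (wedge (dual b4.X0) (dual b4.Y0))
    \<in> g41.cocycles 2"
  proof (rule g41.cocycles_2I, goal_cases)
    case (2 X Y Z x y z)
    then show ?case
      by (cases x; cases y; cases z;
        simp add: graded_part4 psign_def form_defs extend_bracket41 algebra_simps)
  qed (intro cochains; simp add: dual_graded_part)
qed

text \<open>Four relations among the eight independent values on basis pairs leave four: two are
  matched by the representatives, two by a linear form on brackets.\<close>

lemma cocycles41_cohomologous:
  assumes \<omega>: "\<omega> \<in> g41.cocycles 2"
  shows "\<exists>\<eta>\<in>forms.span
     {tensor (dual b4.Y0) (dual b4.X1),
      symprod (dual b4.X1) (dual b4.Y1) - scale_form 2 (wedge (dual b4.X0) (dual b4.Y0))}.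
     \<omega> - \<eta> \<in> g41.coboundaries 2" (is "\<exists>\<eta>\<in>forms.span ?S. _")
proof -
  note L = g41.lie_superalgebra_axioms
  note skew = cocycle_basis_skew[OF L \<omega>]
  note closed = cocycle_basis_closed[OF L \<omega>]
  note simps = cocycle_simps[OF L \<omega>] psign_def complex_eq_uminus_iff
  have swap: "\<omega> [e b4.X0, e b4.X0] = 0" "\<omega> [e b4.Y0, e b4.X0] = - \<omega> [e b4.X0, e b4.Y0]"
      "\<omega> [e b4.Y0, e b4.Y0] = 0" "\<omega> [e b4.X1, e b4.X0] = - \<omega> [e b4.X0, e b4.X1]"
      "\<omega> [e b4.X1, e b4.Y0] = - \<omega> [e b4.Y0, e b4.X1]" "\<omega> [e b4.Y1, e b4.X0] = - \<omega> [e b4.X0, e b4.Y1]"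
      "\<omega> [e b4.Y1, e b4.Y0] = - \<omega> [e b4.Y0, e b4.Y1]" "\<omega> [e b4.Y1, e b4.X1] = \<omega> [e b4.X1, e b4.Y1]"
    using skew[of b4.X0 b4.X0] skew[of b4.Y0 b4.X0] skew[of b4.Y0 b4.Y0]
      skew[of b4.X1 b4.X0] skew[of b4.X1 b4.Y0] skew[of b4.Y1 b4.X0]
      skew[of b4.Y1 b4.Y0] skew[of b4.Y1 b4.X1]
    by (simp_all add: simps)
  \<comment> \<open>The triples given to \<open>closed\<close> yield these in order. Odd signs make
    terms add up rather than cancel: \<open>Y1, Y1, Y1\<close> gives 6 times the value at
    \<open>X0, Y1\<close>.\<close>
  have vals: "\<omega> [e b4.X0, e b4.X1] = 0" "\<omega> [e b4.X0, e b4.Y1] = 0" "\<omega> [e b4.X1, e b4.X1] = 0"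
      "\<omega> [e b4.X0, e b4.Y0] = - 2 * \<omega> [e b4.X1, e b4.Y1]"
    using closed[of b4.Y1 b4.Y1 b4.X1] closed[of b4.Y1 b4.Y1 b4.Y1]
      closed[of b4.Y0 b4.Y1 b4.X1] closed[of b4.Y0 b4.Y1 b4.Y1]
    by (simp_all add: simps swap) algebra
  define \<eta> where "\<eta> = scale_form (\<omega> [e b4.Y0, e b4.X1]) (tensor (dual b4.Y0) (dual b4.X1)) +
    scale_form (\<omega> [e b4.X1, e b4.Y1])
      (symprod (dual b4.X1) (dual b4.Y1) - scale_form 2 (wedge (dual b4.X0) (dual b4.Y0)))"
  have "\<eta> \<in> forms.span ?S"
    unfolding \<eta>_def by (intro forms.span_add forms.span_scale forms.span_base) simp_all
  moreover have "\<omega> - \<eta> \<in> g41.coboundaries 2"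
  proof (rule g41.cocycles_2_diffI[OF \<omega>])
    \<comment> \<open>Since \<open>[Y1, Y1] = - 2 X0\<close> and \<open>[Y0, Y1] = - 2 X1\<close>,
      these coefficients reproduce the values of \<open>\<omega>\<close> at the two pairs where
      \<open>\<eta>\<close> vanishes.\<close>
    let ?f = "\<lambda>v. - (\<omega> [e b4.Y1, e b4.Y1] / 2) * v $ b4.X0 - \<omega> [e b4.Y0, e b4.Y1] / 2 * v $ b4.X1"
    show "Vector_Spaces.linear (*s) (*) ?f"
      by (simp add: g41.linear_form_iff field_simps)
    show "\<omega> [X, Y] = \<eta> [X, Y] + ?f (extend_bracket bracket41 X Y)" for X Y
      by (subst cocycle_expansion[OF L \<omega>])
        (simp add: UNIV_b4 swap vals \<eta>_def form_defs extend_bracket41 field_simps)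
    show "\<eta> \<in> g41.cocycles 2"
      unfolding \<eta>_def
      by (intro forms.subspace_add forms.subspace_scale g41.subspace_cocycles cocycles41)
  qed
  ultimately show ?thesis by blast
qed

text \<open>Five of the eight independent values vanish, and the other three sit at pairs whose
  brackets are, up to sign, the distinct basis vectors \<open>X0\<close>, \<open>X1\<close>,
  \<open>Y1\<close>, so a linear form can prescribe them freely.\<close>

lemma cocycles42_coboundary:
  assumes \<omega>: "\<omega> \<in> g42.cocycles 2"
  shows "\<omega> \<in> g42.coboundaries 2"
proof -
  note L = g42.lie_superalgebra_axioms
  note skew = cocycle_basis_skew[OF L \<omega>]
  note closed = cocycle_basis_closed[OF L \<omega>]
  note simps = cocycle_simps[OF L \<omega>] psign_def complex_eq_uminus_iff
  have swap: "\<omega> [e b4.X0, e b4.X0] = 0" "\<omega> [e b4.Y0, e b4.X0] = - \<omega> [e b4.X0, e b4.Y0]"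
      "\<omega> [e b4.Y0, e b4.Y0] = 0" "\<omega> [e b4.X1, e b4.X0] = - \<omega> [e b4.X0, e b4.X1]"
      "\<omega> [e b4.X1, e b4.Y0] = - \<omega> [e b4.Y0, e b4.X1]" "\<omega> [e b4.Y1, e b4.X0] = - \<omega> [e b4.X0, e b4.Y1]"
      "\<omega> [e b4.Y1, e b4.Y0] = - \<omega> [e b4.Y0, e b4.Y1]" "\<omega> [e b4.Y1, e b4.X1] = \<omega> [e b4.X1, e b4.Y1]"
    using skew[of b4.X0 b4.X0] skew[of b4.Y0 b4.X0] skew[of b4.Y0 b4.Y0]
      skew[of b4.X1 b4.X0] skew[of b4.X1 b4.Y0] skew[of b4.Y1 b4.X0]
      skew[of b4.Y1 b4.Y0] skew[of b4.Y1 b4.X1]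
    by (simp_all add: simps)
  have vals: "\<omega> [e b4.X1, e b4.X1] = 0" "\<omega> [e b4.Y1, e b4.Y1] = 0" "\<omega> [e b4.X0, e b4.Y0] = 0"
      "\<omega> [e b4.X0, e b4.X1] = 0" "\<omega> [e b4.X0, e b4.Y1] = 0"
    using closed[of b4.Y0 b4.X1 b4.X1] closed[of b4.Y0 b4.Y1 b4.Y1]
      closed[of b4.Y0 b4.X1 b4.Y1] closed[of b4.X1 b4.Y1 b4.X1]
      closed[of b4.X1 b4.Y1 b4.Y1]
    by (simp_all add: simps swap)
  have "\<omega> - 0 \<in> g42.coboundaries 2"
  proof (rule g42.cocycles_2_diffI[OF \<omega>])
    \<comment> \<open>Read off from \<open>[X1, Y1] = X0\<close>, \<open>[Y0, X1] = X1\<close> and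
      \<open>[Y0, Y1] = - Y1\<close>; the last one causes the minus sign.\<close>
    let ?f = "\<lambda>v. \<omega> [e b4.X1, e b4.Y1] * v $ b4.X0 + \<omega> [e b4.Y0, e b4.X1] * v $ b4.X1
      - \<omega> [e b4.Y0, e b4.Y1] * v $ b4.Y1"
    show "Vector_Spaces.linear (*s) (*) ?f"
      by (simp add: g42.linear_form_iff field_simps)
    show "\<omega> [X, Y] = 0 [X, Y] + ?f (extend_bracket bracket42 X Y)" for X Y
      by (subst cocycle_expansion[OF L \<omega>])
        (simp add: UNIV_b4 swap vals form_defs extend_bracket42 field_simps)
  qed (rule forms.subspace_0[OF g42.subspace_cocycles])
  then show ?thesis by simp
qed

text \<open>The tensors are tested only on basis triples with two \<open>Y0\<close>, where skewness
  cancels the terms. The squares are closed because no bracket has a \<open>Z1\<close> or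
  \<open>T1\<close> coordinate. In each of the last two, both parts are tested only on
  \<open>Y0\<close>, \<open>Z1\<close>, \<open>T1\<close>, where they cancel.\<close>

lemma cocycles6:
  "tensor (dual b6.Y0) (dual b6.X1) \<in> g6.cocycles 2"
  "tensor (dual b6.Y0) (dual b6.Y1) \<in> g6.cocycles 2"
  "symprod (dual b6.Z1) (dual b6.Z1) \<in> g6.cocycles 2"
  "symprod (dual b6.T1) (dual b6.T1) \<in> g6.cocycles 2"
  "symprod (dual b6.X1) (dual b6.Z1) - wedge (dual b6.X0) (dual b6.Y0) \<in> g6.cocycles 2"
  "symprod (dual b6.Y1) (dual b6.T1) - wedge (dual b6.X0) (dual b6.Y0) \<in> g6.cocycles 2"
proof -
  note cochains = forms.subspace_diff[OF g6.subspace_cochains]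
    forms.subspace_scale[OF g6.subspace_cochains]
    g6.tensor_cochain g6.symprod_cochain g6.wedge_cochain linear_dual
  show "tensor (dual b6.Y0) (dual b6.X1) \<in> g6.cocycles 2"
  proof (rule g6.cocycles_2I, goal_cases)
    case (2 X Y Z x y z)
    then show ?case
      by (cases x; cases y; cases z;
        simp add: graded_part6 psign_def form_defs extend_bracket6 algebra_simps)
  qed (intro cochains; simp add: dual_graded_part)
  show "tensor (dual b6.Y0) (dual b6.Y1) \<in> g6.cocycles 2"
  proof (rule g6.cocycles_2I, goal_cases)
    case (2 X Y Z x y z)
    then show ?case
      by (cases x; cases y; cases z;
        simp add: graded_part6 psign_def form_defs extend_bracket6 algebra_simps)
  qed (intro cochains; simp add: dual_graded_part)
  show "symprod (dual b6.Z1) (dual b6.Z1) \<in> g6.cocycles 2"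
  proof (rule g6.cocycles_2I, goal_cases)
    case (2 X Y Z x y z)
    then show ?case
      by (cases x; cases y; cases z;
        simp add: graded_part6 psign_def form_defs extend_bracket6 algebra_simps)
  qed (intro cochains; simp add: dual_graded_part)
  show "symprod (dual b6.T1) (dual b6.T1) \<in> g6.cocycles 2"
  proof (rule g6.cocycles_2I, goal_cases)
    case (2 X Y Z x y z)
    then show ?case
      by (cases x; cases y; cases z;
        simp add: graded_part6 psign_def form_defs extend_bracket6 algebra_simps)
  qed (intro cochains; simp add: dual_graded_part)
  show "symprod (dual b6.X1) (dual b6.Z1) - wedge (dual b6.X0) (dual b6.Y0) \<in> g6.cocycles 2"
  proof (rule g6.cocycles_2I, goal_cases)
    case (2 X Y Z x y z)
    then show ?case
      by (cases x; cases y; cases z;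
        simp add: graded_part6 psign_def form_defs extend_bracket6 algebra_simps)
  qed (intro cochains; simp add: dual_graded_part)
  show "symprod (dual b6.Y1) (dual b6.T1) - wedge (dual b6.X0) (dual b6.Y0) \<in> g6.cocycles 2"
  proof (rule g6.cocycles_2I, goal_cases)
    case (2 X Y Z x y z)
    then show ?case
      by (cases x; cases y; cases z;
        simp add: graded_part6 psign_def form_defs extend_bracket6 algebra_simps)
  qed (intro cochains; simp add: dual_graded_part)
qed

text \<open>Ten relations among nineteen independent values leave nine: six for the representatives
  and three for a linear form on brackets.\<close>

lemma cocycles6_cohomologous:
  assumes \<omega>: "\<omega> \<in> g6.cocycles 2"
  shows "\<exists>\<eta>\<in>forms.span
     {tensor (dual b6.Y0) (dual b6.X1),
      tensor (dual b6.Y0) (dual b6.Y1),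
      symprod (dual b6.Z1) (dual b6.Z1),
      symprod (dual b6.T1) (dual b6.T1),
      symprod (dual b6.X1) (dual b6.Z1) - wedge (dual b6.X0) (dual b6.Y0),
      symprod (dual b6.Y1) (dual b6.T1) - wedge (dual b6.X0) (dual b6.Y0)}.
     \<omega> - \<eta> \<in> g6.coboundaries 2" (is "\<exists>\<eta>\<in>forms.span ?S. _")
proof -
  note L = g6.lie_superalgebra_axioms
  note skew = cocycle_basis_skew[OF L \<omega>]
  note closed = cocycle_basis_closed[OF L \<omega>]
  note simps = cocycle_simps[OF L \<omega>] psign_def complex_eq_uminus_iff
  have swap: "\<omega> [e b6.X0, e b6.X0] = 0" "\<omega> [e b6.Y0, e b6.X0] = - \<omega> [e b6.X0, e b6.Y0]"
      "\<omega> [e b6.Y0, e b6.Y0] = 0" "\<omega> [e b6.X1, e b6.X0] = - \<omega> [e b6.X0, e b6.X1]"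
      "\<omega> [e b6.X1, e b6.Y0] = - \<omega> [e b6.Y0, e b6.X1]" "\<omega> [e b6.Y1, e b6.X0] = - \<omega> [e b6.X0, e b6.Y1]"
      "\<omega> [e b6.Y1, e b6.Y0] = - \<omega> [e b6.Y0, e b6.Y1]" "\<omega> [e b6.Y1, e b6.X1] = \<omega> [e b6.X1, e b6.Y1]"
      "\<omega> [e b6.Z1, e b6.X0] = - \<omega> [e b6.X0, e b6.Z1]" "\<omega> [e b6.Z1, e b6.Y0] = - \<omega> [e b6.Y0, e b6.Z1]"
      "\<omega> [e b6.Z1, e b6.X1] = \<omega> [e b6.X1, e b6.Z1]" "\<omega> [e b6.Z1, e b6.Y1] = \<omega> [e b6.Y1, e b6.Z1]"
      "\<omega> [e b6.T1, e b6.X0] = - \<omega> [e b6.X0, e b6.T1]" "\<omega> [e b6.T1, e b6.Y0] = - \<omega> [e b6.Y0, e b6.T1]"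
      "\<omega> [e b6.T1, e b6.X1] = \<omega> [e b6.X1, e b6.T1]" "\<omega> [e b6.T1, e b6.Y1] = \<omega> [e b6.Y1, e b6.T1]"
      "\<omega> [e b6.T1, e b6.Z1] = \<omega> [e b6.Z1, e b6.T1]"
    using skew[of b6.X0 b6.X0] skew[of b6.Y0 b6.X0] skew[of b6.Y0 b6.Y0]
      skew[of b6.X1 b6.X0] skew[of b6.X1 b6.Y0] skew[of b6.Y1 b6.X0]
      skew[of b6.Y1 b6.Y0] skew[of b6.Y1 b6.X1] skew[of b6.Z1 b6.X0]
      skew[of b6.Z1 b6.Y0] skew[of b6.Z1 b6.X1] skew[of b6.Z1 b6.Y1]
      skew[of b6.T1 b6.X0] skew[of b6.T1 b6.Y0] skew[of b6.T1 b6.X1]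
      skew[of b6.T1 b6.Y1] skew[of b6.T1 b6.Z1]
    by (simp_all add: simps)
  \<comment> \<open>Again in the order of the triples below; the last triple
    \<open>Y0, Z1, T1\<close> gives the only relation that is not a vanishing.\<close>
  have vals: "\<omega> [e b6.X1, e b6.X1] = 0" "\<omega> [e b6.X1, e b6.Y1] = 0" "\<omega> [e b6.Y1, e b6.Y1] = 0"
      "\<omega> [e b6.Y1, e b6.Z1] = 0" "\<omega> [e b6.X1, e b6.T1] = 0" "\<omega> [e b6.X0, e b6.X1] = 0"
      "\<omega> [e b6.X0, e b6.Y1] = 0" "\<omega> [e b6.X0, e b6.Z1] = 0" "\<omega> [e b6.X0, e b6.T1] = 0"
      "\<omega> [e b6.X0, e b6.Y0] = - \<omega> [e b6.X1, e b6.Z1] - \<omega> [e b6.Y1, e b6.T1]"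
    using closed[of b6.Y0 b6.T1 b6.X1] closed[of b6.Y0 b6.Z1 b6.X1]
      closed[of b6.Y0 b6.Z1 b6.Y1] closed[of b6.Y0 b6.Z1 b6.Z1]
      closed[of b6.Y0 b6.T1 b6.T1] closed[of b6.Z1 b6.T1 b6.X1]
      closed[of b6.Z1 b6.T1 b6.Y1] closed[of b6.Z1 b6.T1 b6.Z1]
      closed[of b6.Z1 b6.T1 b6.T1] closed[of b6.Y0 b6.Z1 b6.T1]
    by (simp_all add: simps swap) algebra
  \<comment> \<open>Each coefficient is read off at a pair where only its own representative is
    nonzero; the halves occur because the squares take the value 2 there.\<close>
  define \<eta> where "\<eta> = scale_form (\<omega> [e b6.Y0, e b6.X1]) (tensor (dual b6.Y0) (dual b6.X1)) +
    scale_form (\<omega> [e b6.Y0, e b6.Y1]) (tensor (dual b6.Y0) (dual b6.Y1)) +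
    scale_form (\<omega> [e b6.Z1, e b6.Z1] / 2) (symprod (dual b6.Z1) (dual b6.Z1)) +
    scale_form (\<omega> [e b6.T1, e b6.T1] / 2) (symprod (dual b6.T1) (dual b6.T1)) +
    scale_form (\<omega> [e b6.X1, e b6.Z1])
      (symprod (dual b6.X1) (dual b6.Z1) - wedge (dual b6.X0) (dual b6.Y0)) +
    scale_form (\<omega> [e b6.Y1, e b6.T1])
      (symprod (dual b6.Y1) (dual b6.T1) - wedge (dual b6.X0) (dual b6.Y0))"
  have "\<eta> \<in> forms.span ?S"
    unfolding \<eta>_def by (intro forms.span_add forms.span_scale forms.span_base) simp_all
  moreover have "\<omega> - \<eta> \<in> g6.coboundaries 2"
  proof (rule g6.cocycles_2_diffI[OF \<omega>])
    \<comment> \<open>The brackets \<open>[Z1, T1] = - X0\<close>, \<open>[Y0, Z1] = - Y1\<close>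
      and \<open>[Y0, T1] = - X1\<close> dictate the coefficients; the three values are those that
      \<open>\<eta>\<close> leaves out.\<close>
    let ?f = "\<lambda>v. - \<omega> [e b6.Z1, e b6.T1] * v $ b6.X0 - \<omega> [e b6.Y0, e b6.Z1] * v $ b6.Y1
      - \<omega> [e b6.Y0, e b6.T1] * v $ b6.X1"
    show "Vector_Spaces.linear (*s) (*) ?f"
      by (simp add: g6.linear_form_iff field_simps)
    show "\<omega> [X, Y] = \<eta> [X, Y] + ?f (extend_bracket bracket6 X Y)" for X Y
      by (subst cocycle_expansion[OF L \<omega>])
        (simp add: UNIV_b6 swap vals \<eta>_def form_defs extend_bracket6 field_simps)
    show "\<eta> \<in> g6.cocycles 2"
      unfolding \<eta>_def
      by (intro forms.subspace_add forms.subspace_scale g6.subspace_cocycles cocycles6)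
  qed
  ultimately show ?thesis by blast
qed

theorem theorem2p3p1:
  shows
    "g41.H 2 = g41.H_span 2
      {g41.cohom_class 2 (tensor (dual b4.Y0) (dual b4.X1)),
       g41.cohom_class 2
         (symprod (dual b4.X1) (dual b4.Y1) - scale_form 2 (wedge (dual b4.X0) (dual b4.Y0)))}
   \<and> g42.H 2 = {g42.H_zero 2}
   \<and> g6.H 2 = g6.H_span 2
      {g6.cohom_class 2 (tensor (dual b6.Y0) (dual b6.X1)),
       g6.cohom_class 2 (tensor (dual b6.Y0) (dual b6.Y1)),
       g6.cohom_class 2 (symprod (dual b6.Z1) (dual b6.Z1)),
       g6.cohom_class 2 (symprod (dual b6.T1) (dual b6.T1)),
       g6.cohom_class 2 (symprod (dual b6.X1) (dual b6.Z1) - wedge (dual b6.X0) (dual b6.Y0)),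
       g6.cohom_class 2 (symprod (dual b6.Y1) (dual b6.T1) - wedge (dual b6.X0) (dual b6.Y0))}"
proof (intro conjI)
  show "g42.H 2 = {g42.H_zero 2}"
  proof (intro equalityI subsetI)
    fix a assume "a \<in> g42.H 2"
    then obtain \<omega> where \<omega>: "\<omega> \<in> g42.cocycles 2" "a = g42.cohom_class 2 \<omega>"
      unfolding g42.H_def by blast
    have "g42.cohom_class 2 \<omega> = g42.cohom_class 2 0"
      unfolding g42.cohom_class_eq_iff using cocycles42_coboundary[OF \<omega>(1)] by simp
    then show "a \<in> {g42.H_zero 2}" using \<omega>(2) by (simp add: g42.H_zero_def)
  next
    \<comment> \<open>The zero class belongs to \<open>H 2\<close> because \<open>H 2\<close> is a
      subspace of itself.\<close>
    show "a \<in> g42.H 2" if "a \<in> {g42.H_zero 2}" for a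
      using that g42.H_subspace_H[of 2] by (simp add: g42.H_subspace_def)
  qed
\<comment> \<open>The image of each finite set of representatives under \<open>cohom_class 2\<close>
  simplifies to the listed set of classes.\<close>
qed (use g41.H_eq_H_span[OF _ cocycles41_cohomologous] g6.H_eq_H_span[OF _ cocycles6_cohomologous]
  cocycles41 cocycles6 in simp_all)

end
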